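(* Let $p$ be a prime, let $n>0$ be an integer, and let $f_1,f_2\in\mathbb{F}_p[X]$ be distinct monic irreducible polynomials of degree $n$. Then inverse chaining with respect to $(f_1,f_2)$ induces a unique partition of $\mathcal{P}(p,n)\setminus\{0,1,\ldots,p-1\}$ into cycles of even length $\ge 4$. That is, there is a unique partition of $\mathcal{P}(p,n)\setminus\{0,1,\ldots,p-1\}$ into (undirected) cycles such that for every $a\in\mathcal{P}(p,n)\setminus\{0,1,\ldots,p-1\}$ the inverse chain of $a$ with respect to $(f_1,f_2)$ is a traversal of the cycle containing $a$, and every cycle in this partition has even length at least $4$.
   Context: $\mathbb{F}_p=\mathbb{Z}/p\mathbb{Z}$. $\mathcal{P}(p,n)$ denotes the set of all polynomials in $\mathbb{F}_p[X]$ of degree at most $n-1$ (including $0$); $\{0,1,\ldots,p-1\}$ denotes the set of constant polynomials, identified with $\mathbb{F}_p$. For a monic irreducible polynomial $f\in\mathbb{F}_p[X]$ of degree $n$ and a non-zero $a\in\mathcal{P}(p,n)$, $\mathrm{inv}_f(a)\in\mathcal{P}(p,n)$ denotes the multiplicative inverse of $a$ with respect to $f$: the unique polynomial of degree at most $n-1$ with $a\cdot \mathrm{inv}_f(a)\equiv 1 \pmod{f}$. For an integer $k>0$ and a non-zero $a\in\mathcal{P}(p,n)$, the $k$-chain of $a$ with respect to $(f_1,f_2)$ is the sequence $(a_0,a_1,\ldots,a_k)$ defined by $a_0=a$, $a_i=\mathrm{inv}_{f_1}(a_{i-1})$ if $i$ is odd, and $a_i=\mathrm{inv}_{f_2}(a_{i-1})$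 if $i\ge 2$ is even. For non-constant $a$, the inverse chain of $a$ with respect to $(f_1,f_2)$ is the $k$-chain $(a_0,\ldots,a_k)$ with $k>0$ even, $a_k=a_0=a$, and $a_0,\ldots,a_{k-1}$ all distinct; it is viewed as a cycle of length $k$ on the vertices $a_0,\ldots,a_{k-1}$, with consecutive elements joined by edges (including the edge between $a_{k-1}$ and $a_0$). *)

theory Defs
  imports
    "HOL-Library.Disjoint_Sets"
    "HOL-Number_Theory.Cong"
    "Berlekamp_Zassenhaus.Finite_Field"
begin

section \<open>Inverse chains\<close>

text \<open>
  The field of \<open>p\<close> elements is \<^typ>\<open>'p :: prime_card mod_ring\<close>, the integers modulo
  \<open>CARD('p)\<close>, where the class \<^class>\<open>prime_card\<close> says that \<open>CARD('p)\<close> is prime.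
\<close>

text \<open>
  \<open>\<P>(p,n)\<close>. The degree of the zero polynomial is \<open>0\<close> in the library, so that
  \<open>degree a < n\<close> also covers \<open>a = 0\<close> when \<open>n > 0\<close>.
\<close>
definition polys_below :: "nat \<Rightarrow> 'a::zero poly set" where
  "polys_below n = {a. a = 0 \<or> degree a < n}"

definition const_polys :: "'a::zero poly set" where
  "const_polys = range (\<lambda>c. [:c:])"

definition poly_inv :: "'a::field poly \<Rightarrow> 'a poly \<Rightarrow> 'a poly" where
  "poly_inv f a = (THE b. b \<in> polys_below (degree f) \<and> [a * b = 1] (mod f))"

fun chain_elem :: "'a::field poly \<Rightarrow> 'a poly \<Rightarrow> 'a poly \<Rightarrow> nat \<Rightarrow> 'a poly" where
  "chain_elem f1 f2 a 0 = a"
| "chain_elem f1 f2 a (Suc i) =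
     (if odd (Suc i) then poly_inv f1 (chain_elem f1 f2 a i)
      else poly_inv f2 (chain_elem f1 f2 a i))"

definition k_chain :: "'a::field poly \<Rightarrow> 'a poly \<Rightarrow> nat \<Rightarrow> 'a poly \<Rightarrow> 'a poly list" where
  "k_chain f1 f2 k a = map (chain_elem f1 f2 a) [0..<Suc k]"

text \<open>
  A predicate rather than a function, since the existence of the inverse chain is not part of
  its definition. By \<open>is_inverse_chain_unique\<close> below there is at most one.
\<close>
definition is_inverse_chain ::
    "'a::field poly \<Rightarrow> 'a poly \<Rightarrow> 'a poly \<Rightarrow> 'a poly list \<Rightarrow> bool" where
  "is_inverse_chain f1 f2 a xs \<longleftrightarrow>
     (\<exists>k>0. even k \<and> xs = k_chain f1 f2 k a \<and> xs ! k = a \<and> distinct (take k xs))"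

lemma is_inverse_chain_unique:
  assumes "is_inverse_chain f1 f2 a xs" "is_inverse_chain f1 f2 a ys"
  shows "xs = ys"
proof -
  have *: False
    if k: "0 < k" "k_chain f1 f2 k a ! k = a"
      and l: "distinct (take l (k_chain f1 f2 l a))" and kl: "k < l" for k l
  proof -
    have "inj_on (chain_elem f1 f2 a) {0..<l}"
      using l by (simp add: k_chain_def take_map distinct_map)
    moreover have "chain_elem f1 f2 a k = a"
      using k(2) by (simp add: k_chain_def nth_append)
    then have "chain_elem f1 f2 a k = chain_elem f1 f2 a 0"
      by simp
    ultimately show False
      using k(1) kl inj_onD[of "chain_elem f1 f2 a" "{0..<l}" k 0] by simp
  qed
  obtain k where k: "0 < k" "xs = k_chain f1 f2 k a" "xs ! k = a" "distinct (take k xs)"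
    using assms(1) by (auto simp: is_inverse_chain_def)
  obtain l where l: "0 < l" "ys = k_chain f1 f2 l a" "ys ! l = a" "distinct (take l ys)"
    using assms(2) by (auto simp: is_inverse_chain_def)
  have "k = l"
    using *[of k l] *[of l k] k l by (metis linorder_neqE_nat)
  then show ?thesis
    using k(2) l(2) by simp
qed

section \<open>Partitions into undirected cycles\<close>

text \<open>
  An undirected cycle is represented as a simple graph (vertex set and set of edges, an edge
  being the set of its end points). A traversal of it is a list \<open>[v\<^sub>0, \<dots>, v\<^sub>k]\<close> with \<open>k > 0\<close>,
  \<open>v\<^sub>k = v\<^sub>0\<close> and \<open>v\<^sub>0, \<dots>, v\<^bsub>k-1\<^esub>\<close> distinct that runs once around the cycle. The degenerate
  lengths \<open>1\<close> (one edge \<open>{v\<^sub>0}\<close>) and \<open>2\<close> (one edge \<open>{v\<^sub>0, v\<^sub>1}\<close>) are deliberately admitted: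
  a lower bound on the length of a cycle is not built into the definition.
\<close>
type_synonym 'v ucycle = "'v set \<times> 'v set set"

abbreviation cycle_verts :: "'v ucycle \<Rightarrow> 'v set" where
  "cycle_verts \<equiv> fst"

abbreviation cycle_edges :: "'v ucycle \<Rightarrow> 'v set set" where
  "cycle_edges \<equiv> snd"

definition traverses :: "'v list \<Rightarrow> 'v ucycle \<Rightarrow> bool" where
  "traverses xs C \<longleftrightarrow>
     2 \<le> length xs \<and> hd xs = last xs \<and> distinct (butlast xs) \<and>
     cycle_verts C = set xs \<and>
     cycle_edges C = {{xs ! i, xs ! Suc i} | i. Suc i < length xs}"

definition is_ucycle :: "'v ucycle \<Rightarrow> bool" where
  "is_ucycle C \<longleftrightarrow> (\<exists>xs. traverses xs C)"

definition cycle_length :: "'v ucycle \<Rightarrow> nat" where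
  "cycle_length C = card (cycle_verts C)"

definition cycle_partition :: "'v set \<Rightarrow> 'v ucycle set \<Rightarrow> bool" where
  "cycle_partition A P \<longleftrightarrow>
     (\<forall>C\<in>P. is_ucycle C) \<and> disjoint_family_on cycle_verts P \<and> (\<Union>C\<in>P. cycle_verts C) = A"

definition inverse_chain_partition ::
    "'a::field poly \<Rightarrow> 'a poly \<Rightarrow> 'a poly set \<Rightarrow> 'a poly ucycle set \<Rightarrow> bool" where
  "inverse_chain_partition f1 f2 A P \<longleftrightarrow>
     cycle_partition A P \<and>
     (\<forall>a\<in>A. \<exists>xs. is_inverse_chain f1 f2 a xs \<and>
        (\<forall>C\<in>P. a \<in> cycle_verts C \<longrightarrow> traverses xs C))"

end

theory Submission
  imports Defs
begin

text \<open>
  Let \<open>A\<close> be the finite set of non-constant polynomials of degree less than \<open>n\<close>. Inversion modulo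
  \<open>f\<^sub>1\<close> and inversion modulo \<open>f\<^sub>2\<close> are involutions \<open>s\<close> and \<open>t\<close> of \<open>A\<close>. Neither has a fixed point:
  \<open>a\<^sup>2 \<equiv> 1\<close> modulo an irreducible \<open>f\<close> forces \<open>f\<close> to divide \<open>a - 1\<close> or \<open>a + 1\<close>, which is impossible
  for a non-constant \<open>a\<close> of smaller degree (\<open>poly_inv_nonconst\<close>).

  The inverse chain of \<open>a\<close> is therefore the alternating walk \<open>a, s a, t (s a), \<dots>\<close>. Two positions of
  different parity never carry the same point (\<open>walk_neq_of_odd_gap\<close>), and an equality between
  positions of the same parity can be moved back to the start of the walk
  (\<open>walk_eq_imp_return\<close>). Hence the walk is a closed one whose length is the least positive even
  \<open>k\<close> at which it returns to \<open>a\<close>, its first \<open>k\<close> points are distinct, and they form the orbit of \<open>a\<close>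
  under \<open>s\<close> and \<open>t\<close>. The edges traversed are exactly the pairs \<open>{v, s v}\<close> and \<open>{v, t v}\<close> with \<open>v\<close> in
  the orbit, so that the cycle depends on the orbit only (\<open>edges_closed_walk\<close>,
  \<open>orbit_cycle_eq\<close>), and the orbits partition \<open>A\<close>. The partition is unique because a traversal
  determines the cycle that it traverses.

  The length \<open>2\<close> would mean \<open>s a = t a\<close>. If this common inverse is \<open>b\<close>, then the coprime
  polynomials \<open>f\<^sub>1\<close> and \<open>f\<^sub>2\<close> both divide \<open>a b - 1\<close>, and so does their product, of degree \<open>2 n\<close>; but
  \<open>a b - 1\<close> is non-zero of degree at most \<open>2 n - 2\<close> (\<open>poly_inv_neq_poly_inv\<close>).
\<close>

section \<open>Two fixed-point-free involutions of a finite set\<close>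

text \<open>The involutions are only constrained on \<open>A\<close>; their values elsewhere are arbitrary.\<close>
locale fixed_point_free_involutions =
  fixes A :: "'v set" and s t :: "'v \<Rightarrow> 'v"
  assumes finite_A: "finite A"
    and s_closed: "a \<in> A \<Longrightarrow> s a \<in> A" and t_closed: "a \<in> A \<Longrightarrow> t a \<in> A"
    and s_invol: "a \<in> A \<Longrightarrow> s (s a) = a" and t_invol: "a \<in> A \<Longrightarrow> t (t a) = a"
    and s_no_fix: "a \<in> A \<Longrightarrow> s a \<noteq> a" and t_no_fix: "a \<in> A \<Longrightarrow> t a \<noteq> a"
begin

text \<open>The sequence \<open>a, s a, t (s a), s (t (s a)), \<dots>\<close>.\<close>
primrec walk :: "'v \<Rightarrow> nat \<Rightarrow> 'v" where
  "walk a 0 = a"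
| "walk a (Suc i) = (if even i then s (walk a i) else t (walk a i))"

lemma walk_closed: "a \<in> A \<Longrightarrow> walk a i \<in> A"
  by (induction i) (auto intro: s_closed t_closed)

lemma walk_back:
  assumes "a \<in> A"
  shows "(if even i then s else t) (walk a (Suc i)) = walk a i"
  using walk_closed[OF assms, of i] by (simp add: s_invol t_invol)

text \<open>
  If two positions of different parity agreed, then moving both of them one step towards each
  other would apply the same involution to both sides; in the end two neighbours would agree,
  which is a fixed point of \<open>s\<close> or \<open>t\<close>.
\<close>
lemma walk_neq_of_odd_gap:
  assumes "a \<in> A"
  shows "walk a i \<noteq> walk a (i + 2 * d + 1)"
proof (induction d arbitrary: i)
  case 0
  show ?case
    using walk_closed[OF assms, of i] s_no_fix[of "walk a i"] t_no_fix[of "walk a i"] by auto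
next
  case (Suc d)
  have "walk a (Suc i) \<noteq> walk a (Suc i + 2 * d + 1)"
    by (rule Suc.IH)
  moreover have "walk a (Suc i) = (if even i then s else t) (walk a i)"
    by simp
  moreover have "walk a (Suc i + 2 * d + 1) =
      (if even i then s else t) (walk a (i + 2 * Suc d + 1))"
    using walk_back[OF assms, of "i + 2 * Suc d"] by simp
  ultimately show ?case
    by metis
qed

text \<open>At positions of the same parity the last step applied the same involution, so it can be undone
  on both sides of an equality.\<close>
lemma walk_eq_shift_back:
  assumes "a \<in> A" "even d" "walk a i = walk a (i + d)"
  shows "walk a d = a"
  using assms(3)
proof (induction i)
  case (Suc i)
  have "walk a i = (if even i then s else t) (walk a (Suc i))"
    using walk_back[OF assms(1)] by simp
  also have "\<dots> = (if even i then s else t) (walk a (Suc (i + d)))"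
    using Suc.prems by (simp only: add_Suc)
  also have "\<dots> = walk a (i + d)"
    using walk_back[OF assms(1), of "i + d"] assms(2) by (simp del: walk.simps)
  finally show ?case
    by (rule Suc.IH)
qed simp

lemma walk_eq_imp_return:
  assumes "a \<in> A" "i < j" "walk a i = walk a j"
  shows "even (j - i)" "walk a (j - i) = a"
proof -
  show ev: "even (j - i)"
  proof (rule ccontr)
    assume "odd (j - i)"
    then obtain d where "j - i = 2 * d + 1"
      by (rule oddE)
    then have "j = i + 2 * d + 1"
      using assms(2) by simp
    then show False
      using walk_neq_of_odd_gap[OF assms(1), of i d] assms(3) by simp
  qed
  show "walk a (j - i) = a"
    using walk_eq_shift_back[OF assms(1) ev, of i] assms(2,3) by simp
qed

text \<open>
  The length of the closed walk from \<open>a\<close>. The condition that \<open>k\<close> is even excludes nothing, since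
  by \<open>walk_neq_of_odd_gap\<close> the walk never returns to \<open>a\<close> at an odd position.
\<close>
definition period :: "'v \<Rightarrow> nat" where
  "period a = (LEAST k. 0 < k \<and> even k \<and> walk a k = a)"

lemma period:
  assumes "a \<in> A"
  shows "0 < period a" "even (period a)" "walk a (period a) = a"
proof -
  have "\<not> inj (walk a)"
    using finite_subset[OF _ finite_A, of "range (walk a)"] walk_closed[OF assms]
      finite_imageD[of "walk a" UNIV] by auto
  then obtain i j where "i < j" "walk a i = walk a j"
    unfolding inj_def by (metis linorder_neqE_nat)
  then have "0 < j - i \<and> even (j - i) \<and> walk a (j - i) = a"
    using walk_eq_imp_return[OF assms] by auto
  then have "0 < period a \<and> even (period a) \<and> walk a (period a) = a"
    unfolding period_def by (rule LeastI)
  then show "0 < period a" "even (period a)" "walk a (period a) = a"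
    by auto
qed

lemma inj_on_walk:
  assumes "a \<in> A"
  shows "inj_on (walk a) {..<period a}"
proof (rule linorder_inj_onI)
  fix i j assume ij: "i < j" "i \<in> {..<period a}" "j \<in> {..<period a}"
  show "walk a i \<noteq> walk a j"
  proof
    assume "walk a i = walk a j"
    from walk_eq_imp_return[OF assms ij(1) this]
    have "period a \<le> j - i"
      unfolding period_def using ij(1) by (intro Least_le) auto
    then show False
      using ij by auto
  qed
qed auto

lemma t_eq_walk_pred_period:
  assumes "a \<in> A"
  shows "t a = walk a (period a - 1)"
proof -
  obtain m where m: "period a = Suc m"
    using period(1)[OF assms] gr0_implies_Suc by blast
  then show ?thesis
    using walk_back[OF assms, of m] period(2,3)[OF assms] by (simp del: walk.simps)
qed

text \<open>The images \<open>s v\<close> and \<open>t v\<close> of a point \<open>v\<close> of the walk are adjacent to it on the closed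
  walk; \<open>t a\<close> is the last point before the walk returns to \<open>a\<close>.\<close>
lemma step_in_walk:
  assumes "a \<in> A" "i < period a" "u \<in> {s (walk a i), t (walk a i)}"
  shows "\<exists>j < period a. {walk a i, u} = {walk a j, walk a (Suc j)}"
proof (cases "u = walk a (Suc i)")
  case True
  then show ?thesis
    using assms(2) by blast
next
  case ne: False
  show ?thesis
  proof (cases i)
    case 0
    then have "u = walk a (period a - 1)"
      using ne assms(3) t_eq_walk_pred_period[OF assms(1)] by simp
    moreover have "walk a i = walk a (Suc (period a - 1))"
      using 0 period[OF assms(1)] by (simp del: walk.simps(2))
    ultimately show ?thesis
      using period(1)[OF assms(1)]
      by (intro exI[of _ "period a - 1"]) (simp del: walk.simps add: insert_commute)
  next
    case (Suc m)
    then have "u = (if even m then s else t) (walk a (Suc m))"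
      using ne assms(3) by (auto split: if_splits)
    then have "u = walk a m"
      using walk_back[OF assms(1), of m] by (simp del: walk.simps)
    then show ?thesis
      using Suc assms(2) by (intro exI[of _ m]) (simp del: walk.simps add: insert_commute)
  qed
qed

text \<open>
  The points of the walk from \<open>a\<close>; by \<open>orbit_closed\<close> this is the orbit of \<open>a\<close> under \<open>s\<close> and \<open>t\<close>.
\<close>
definition orbit :: "'v \<Rightarrow> 'v set" where
  "orbit a = walk a ` {..<period a}"

lemma walk_in_orbit:
  assumes "a \<in> A" "i \<le> period a"
  shows "walk a i \<in> orbit a"
proof (cases "i = period a")
  case True
  then show ?thesis
    using period[OF assms(1)] unfolding orbit_def by (auto intro!: image_eqI[of _ _ 0])
qed (use assms(2) in \<open>auto simp: orbit_def\<close>)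

lemma orbit_self: "a \<in> A \<Longrightarrow> a \<in> orbit a"
  using walk_in_orbit[of a 0] by simp

lemma orbit_subset: "a \<in> A \<Longrightarrow> orbit a \<subseteq> A"
  unfolding orbit_def using walk_closed by auto

lemma orbit_closed:
  assumes "a \<in> A" "v \<in> orbit a"
  shows "s v \<in> orbit a" "t v \<in> orbit a"
proof -
  have *: "u \<in> orbit a" if u: "u \<in> {s v, t v}" for u
  proof -
    obtain i where i: "i < period a" "v = walk a i"
      using assms(2) unfolding orbit_def by auto
    obtain j where j: "j < period a" "{walk a i, u} = {walk a j, walk a (Suc j)}"
      using step_in_walk[OF assms(1) i(1) u[unfolded i(2)]] by (elim exE conjE)
    then have "{walk a i, u} \<subseteq> orbit a"
      unfolding j(2) using walk_in_orbit[OF assms(1), of j] walk_in_orbit[OF assms(1), of "Suc j"]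
      by (simp del: walk.simps)
    then show ?thesis
      by simp
  qed
  show "s v \<in> orbit a" "t v \<in> orbit a"
    using * by auto
qed

lemma orbit_subset_orbit:
  assumes "a \<in> A" "b \<in> orbit a"
  shows "orbit b \<subseteq> orbit a"
proof -
  have "walk b i \<in> orbit a" for i
    by (induction i) (use assms orbit_closed[OF assms(1)] in auto)
  then show ?thesis
    by (auto simp: orbit_def[of b])
qed

lemma orbit_sym:
  assumes "a \<in> A" "b \<in> orbit a"
  shows "a \<in> orbit b"
proof -
  obtain i where i: "b = walk a i"
    using assms(2) unfolding orbit_def by auto
  have b: "b \<in> A"
    using i walk_closed[OF assms(1)] by simp
  \<comment> \<open>Walking backwards from \<open>b\<close> also applies \<open>s\<close> and \<open>t\<close> alternately, so it stays in the orbit.\<close>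
  have "walk a (i - d) \<in> orbit b" for d
  proof (induction d)
    case 0
    then show ?case
      using i orbit_self[OF b] by simp
  next
    case (Suc d)
    show ?case
    proof (cases "i - d")
      case 0
      then show ?thesis
        using Suc by simp
    next
      case (Suc m)
      then have "walk a (Suc m) \<in> orbit b" "i - Suc d = m"
        using Suc.IH by (simp_all del: walk.simps)
      then show ?thesis
        using walk_back[OF assms(1), of m] orbit_closed[OF b, of "walk a (Suc m)"]
        by (metis (full_types))
    qed
  qed
  from this[of i] show ?thesis
    by simp
qed

lemma orbit_eq:
  assumes "a \<in> A" "b \<in> orbit a"
  shows "orbit b = orbit a"
  using orbit_subset_orbit[OF assms] orbit_subset_orbit[OF _ orbit_sym[OF assms]]
    orbit_subset[OF assms(1)] assms(2) by blast

text \<open>The cycle through \<open>a\<close>. Its edges are described by the orbit alone, so that points of the same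
  orbit visibly have the same cycle.\<close>
definition orbit_cycle :: "'v \<Rightarrow> 'v ucycle" where
  "orbit_cycle a = (orbit a, (\<Union>v\<in>orbit a. {{v, s v}, {v, t v}}))"

lemma cycle_verts_orbit_cycle [simp]: "cycle_verts (orbit_cycle a) = orbit a"
  by (simp add: orbit_cycle_def)

lemma orbit_cycle_eq:
  assumes "a \<in> A" "b \<in> orbit a"
  shows "orbit_cycle b = orbit_cycle a"
  using orbit_eq[OF assms] by (simp add: orbit_cycle_def)

text \<open>The walk from \<open>a\<close> up to and including its return to \<open>a\<close>.\<close>
definition closed_walk :: "'v \<Rightarrow> 'v list" where
  "closed_walk a = map (walk a) [0..<Suc (period a)]"

lemma closed_walk_nth: "i \<le> period a \<Longrightarrow> closed_walk a ! i = walk a i"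
  by (simp add: closed_walk_def nth_append del: upt_Suc)

lemma distinct_closed_walk: "a \<in> A \<Longrightarrow> distinct (take (period a) (closed_walk a))"
  using inj_on_walk[of a] by (simp add: closed_walk_def distinct_map atLeast0LessThan)

lemma length_closed_walk: "length (closed_walk a) = Suc (period a)"
  by (simp add: closed_walk_def)

lemma set_closed_walk:
  assumes "a \<in> A"
  shows "set (closed_walk a) = orbit a"
proof -
  have "set (closed_walk a) = insert (walk a (period a)) (orbit a)"
    by (simp add: closed_walk_def orbit_def atLeast0LessThan)
  then show ?thesis
    using period(3)[OF assms] orbit_self[OF assms] by auto
qed

lemma edges_closed_walk:
  assumes "a \<in> A"
  shows "{{closed_walk a ! i, closed_walk a ! Suc i} | i. Suc i < length (closed_walk a)} =
    (\<Union>v\<in>orbit a. {{v, s v}, {v, t v}})" (is "?L = ?R")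
proof -
  have "?L = {{walk a i, walk a (Suc i)} | i. i < period a}"
    by (auto simp: length_closed_walk closed_walk_nth simp del: walk.simps)
      (metis Suc_leI closed_walk_nth less_imp_le)+
  also have "\<dots> = ?R"
  proof (intro equalityI subsetI)
    fix e assume "e \<in> {{walk a i, walk a (Suc i)} | i. i < period a}"
    then obtain i where "e = {walk a i, walk a (Suc i)}" "i < period a"
      by blast
    then show "e \<in> ?R"
      by (auto simp: orbit_def)
  next
    fix e assume "e \<in> ?R"
    then obtain i u where "i < period a" "u \<in> {s (walk a i), t (walk a i)}" "e = {walk a i, u}"
      by (auto simp: orbit_def)
    then show "e \<in> {{walk a i, walk a (Suc i)} | i. i < period a}"
      using step_in_walk[OF assms, of i u] by (auto simp del: walk.simps)
  qed
  finally show ?thesis .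
qed

lemma traverses_orbit_cycle:
  assumes "a \<in> A"
  shows "traverses (closed_walk a) (orbit_cycle a)"
  unfolding traverses_def
proof (intro conjI)
  show "2 \<le> length (closed_walk a)"
    using period(1)[OF assms] by (simp add: length_closed_walk)
  show "hd (closed_walk a) = last (closed_walk a)"
    using period(3)[OF assms] by (simp add: closed_walk_def hd_append hd_map)
  show "distinct (butlast (closed_walk a))"
    using distinct_closed_walk[OF assms] by (simp add: butlast_conv_take length_closed_walk)
  show "cycle_verts (orbit_cycle a) = set (closed_walk a)"
    by (simp add: set_closed_walk[OF assms])
  show "cycle_edges (orbit_cycle a) =
      {{closed_walk a ! i, closed_walk a ! Suc i} | i. Suc i < length (closed_walk a)}"
    unfolding edges_closed_walk[OF assms] by (simp add: orbit_cycle_def)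
qed

lemma cycle_length_orbit_cycle: "a \<in> A \<Longrightarrow> cycle_length (orbit_cycle a) = period a"
  using card_image[OF inj_on_walk] by (simp add: cycle_length_def orbit_def)

lemma period_ge_4:
  assumes "a \<in> A" "s a \<noteq> t a"
  shows "4 \<le> period a"
proof -
  have "period a \<noteq> 2"
  proof
    assume "period a = 2"
    then have "t a = walk a 1"
      using t_eq_walk_pred_period[OF assms(1)] by simp
    then show False
      using assms(2) by simp
  qed
  moreover have "period a \<noteq> 3"
    using period(2)[OF assms(1)] by auto
  moreover have "period a \<noteq> 1"
    using period(2)[OF assms(1)] by auto
  ultimately show ?thesis
    using period(1)[OF assms(1)] by linarith
qed

lemma cycle_partition_orbit_cycles: "cycle_partition A (orbit_cycle ` A)"
  unfolding cycle_partition_def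
proof (intro conjI ballI)
  fix C assume "C \<in> orbit_cycle ` A"
  then show "is_ucycle C"
    unfolding is_ucycle_def using traverses_orbit_cycle by blast
next
  show "disjoint_family_on cycle_verts (orbit_cycle ` A)"
    unfolding disjoint_family_on_def
  proof (intro ballI impI)
    fix C D assume "C \<in> orbit_cycle ` A" "D \<in> orbit_cycle ` A" and ne: "C \<noteq> D"
    then obtain a b where "a \<in> A" "C = orbit_cycle a" "b \<in> A" "D = orbit_cycle b"
      by blast
    then have "c \<notin> orbit a \<inter> orbit b" for c
      using ne orbit_cycle_eq[of a c] orbit_cycle_eq[of b c] by auto
    then show "cycle_verts C \<inter> cycle_verts D = {}"
      using \<open>C = orbit_cycle a\<close> \<open>D = orbit_cycle b\<close> by auto
  qed
next
  show "(\<Union>C\<in>orbit_cycle ` A. cycle_verts C) = A"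
    using orbit_subset orbit_self by fastforce
qed

end

lemma traverses_unique: "traverses xs C \<Longrightarrow> traverses xs D \<Longrightarrow> C = D"
  by (simp add: traverses_def prod_eq_iff)

lemma cycle_verts_nonempty: "is_ucycle C \<Longrightarrow> cycle_verts C \<noteq> {}"
  by (auto simp: is_ucycle_def traverses_def)

section \<open>Inversion of polynomials modulo an irreducible polynomial\<close>

lemma polys_below_eq: "0 < n \<Longrightarrow> polys_below n = {a. degree a < n}"
  by (auto simp: polys_below_def)

lemma finite_polys_below: "finite (polys_below n :: 'a::{finite,zero} poly set)"
proof -
  have "polys_below n \<subseteq> Poly ` {xs :: 'a list. set xs \<subseteq> UNIV \<and> length xs \<le> n}"
  proof
    fix a :: "'a poly" assume "a \<in> polys_below n"
    then have "length (coeffs a) \<le> n"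
      by (cases "a = 0") (auto simp: polys_below_def length_coeffs_degree Suc_le_eq)
    then show "a \<in> Poly ` {xs. set xs \<subseteq> UNIV \<and> length xs \<le> n}"
      by (intro image_eqI[of _ _ "coeffs a"]) auto
  qed
  then show ?thesis
    by (rule finite_subset) (intro finite_imageI finite_lists_length_le finite)
qed

lemma in_const_polys_iff: "a \<in> const_polys \<longleftrightarrow> degree a = 0"
  by (auto simp: const_polys_def image_iff elim: degree_eq_zeroE)

lemma eq_if_cong_polys_below:
  fixes b c f :: "'a::field_gcd poly"
  assumes "b \<in> polys_below (degree f)" "c \<in> polys_below (degree f)" "[b = c] (mod f)"
  shows "b = c"
proof -
  have "b mod f = b" "c mod f = c"
    using assms(1,2) by (auto simp: polys_below_def mod_poly_less)
  then show ?thesis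
    using assms(3) by (simp add: cong_def)
qed

lemma coprime_irreducible_poly:
  fixes a f :: "'a::field_gcd poly"
  assumes "irreducible f" "a \<noteq> 0" "degree a < degree f"
  shows "coprime a f"
proof -
  have "\<not> f dvd a"
    using assms(2,3) dvd_imp_degree_le leD by blast
  then have "coprime f a"
    by (rule prime_elem_imp_coprime[OF field_poly_irreducible_imp_prime[OF assms(1)]])
  then show ?thesis
    by (subst coprime_commute)
qed

lemma poly_inv_unique:
  fixes a b f :: "'a::field_gcd poly"
  assumes "coprime a f" "b \<in> polys_below (degree f)" "[a * b = 1] (mod f)"
  shows "poly_inv f a = b"
  unfolding poly_inv_def
proof (rule the_equality)
  fix c assume c: "c \<in> polys_below (degree f) \<and> [a * c = 1] (mod f)"
  then have "[a * c = a * b] (mod f)"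
    using assms(3) cong_trans cong_sym by blast
  then have "[c = b] (mod f)"
    using assms(1) by (simp add: cong_mult_lcancel)
  then show "c = b"
    using c assms(2) eq_if_cong_polys_below by blast
qed (use assms in auto)

lemma poly_inv:
  fixes a f :: "'a::field_gcd poly"
  assumes "coprime a f" "f \<noteq> 0"
  shows "poly_inv f a \<in> polys_below (degree f)" "[a * poly_inv f a = 1] (mod f)"
proof -
  obtain c where c: "[a * c = 1] (mod f)"
  proof -
    have "fst (bezout_coefficients a f) * a + snd (bezout_coefficients a f) * f = 1"
      using bezout_coefficients_fst_snd[of a f] assms(1) by simp
    then have "[a * fst (bezout_coefficients a f) = 1] (mod f)"
      by (metis cong_add_rcancel_0 cong_def mod_mult_self1 mult.commute)
    then show ?thesis
      by (rule that)
  qed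
  have below: "c mod f \<in> polys_below (degree f)"
    using degree_mod_less[OF assms(2), of c] by (auto simp: polys_below_def)
  moreover have "[a * (c mod f) = 1] (mod f)"
    using c by (simp add: cong_def mod_mult_right_eq)
  ultimately have "poly_inv f a = c mod f"
    using poly_inv_unique[OF assms(1)] by blast
  then show "poly_inv f a \<in> polys_below (degree f)" "[a * poly_inv f a = 1] (mod f)"
    using below \<open>[a * (c mod f) = 1] (mod f)\<close> by simp_all
qed

lemma nonconst_below_iff:
  "0 < n \<Longrightarrow> a \<in> polys_below n - const_polys \<longleftrightarrow> 0 < degree a \<and> degree a < n"
  by (auto simp: polys_below_eq in_const_polys_iff)

text \<open>Inversion modulo \<open>f\<close> is a fixed-point-free involution of the non-constant polynomials of degree
  less than that of \<open>f\<close>.\<close>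
lemma poly_inv_nonconst:
  fixes a f :: "'a::field_gcd poly"
  assumes "irreducible f" "0 < degree a" "degree a < degree f"
  shows "0 < degree (poly_inv f a)" "degree (poly_inv f a) < degree f"
    and "[a * poly_inv f a = 1] (mod f)" "poly_inv f (poly_inv f a) = a"
    and "poly_inv f a \<noteq> a"
proof -
  let ?b = "poly_inv f a"
  have f0: "f \<noteq> 0" and a0: "a \<noteq> 0" and pos: "0 < degree f"
    using assms by auto
  have cop: "coprime a f"
    using coprime_irreducible_poly[OF assms(1) a0 assms(3)] .
  show deg: "degree ?b < degree f" and inv: "[a * ?b = 1] (mod f)"
    using poly_inv[OF cop f0] pos by (simp_all add: polys_below_eq)
  have b0: "?b \<noteq> 0"
  proof
    assume "?b = 0"
    then have "f dvd 1"
      using inv by (simp add: cong_0_iff cong_sym_eq)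
    then show False
      using irreducible_not_unit[OF assms(1)] by blast
  qed
  show "0 < degree ?b"
  proof (rule ccontr)
    \<comment> \<open>For a constant \<open>?b\<close>, both sides of \<open>[a * ?b = 1] (mod f)\<close> are reduced modulo \<open>f\<close>, hence equal.\<close>
    assume "\<not> 0 < degree ?b"
    then have ab: "degree (a * ?b) = degree a"
      using degree_mult_eq[OF a0 b0] by simp
    then have "a * ?b = 1"
      using eq_if_cong_polys_below[OF _ _ inv] assms(3) pos by (simp add: polys_below_eq)
    then show False
      using ab assms(2) by simp
  qed
  show "poly_inv f ?b = a"
    using poly_inv_unique[OF coprime_irreducible_poly[OF assms(1) b0 deg], of a] inv assms(3) pos
    by (simp add: polys_below_eq mult.commute)
  show "?b \<noteq> a"
  proof
    assume "?b = a"
    then have "f dvd a * a - 1"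
      using inv by (simp add: cong_iff_dvd_diff)
    also have "a * a - 1 = (a - 1) * (a + 1)"
      by (simp add: algebra_simps)
    finally have "f dvd a - 1 \<or> f dvd a + 1"
      using prime_elem_dvd_multD[OF field_poly_irreducible_imp_prime[OF assms(1)]] by blast
    moreover have "degree (a - 1) = degree a" "degree (a + 1) = degree a"
      using degree_add_eq_left[of "- 1" a] degree_add_eq_left[of 1 a] assms(2) by simp_all
    moreover have "a - 1 \<noteq> 0" "a + 1 \<noteq> 0"
      using calculation(2,3) assms(2) by auto
    ultimately show False
      using dvd_imp_degree_le[of f "a - 1"] dvd_imp_degree_le[of f "a + 1"] assms(3) by linarith
  qed
qed

lemma poly_inv_neq_poly_inv:
  fixes a f1 f2 :: "'a::field_gcd poly"
  assumes f1: "monic f1" "irreducible f1" "degree f1 = n"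
    and f2: "monic f2" "irreducible f2" "degree f2 = n"
    and "f1 \<noteq> f2" "0 < degree a" "degree a < n"
  shows "poly_inv f1 a \<noteq> poly_inv f2 a"
proof
  let ?b = "poly_inv f1 a"
  assume eq: "?b = poly_inv f2 a"
  have "f1 dvd a * ?b - 1" "f2 dvd a * ?b - 1"
    using poly_inv_nonconst(3)[OF f1(2), of a] poly_inv_nonconst(3)[OF f2(2), of a] assms eq
    by (simp_all add: cong_iff_dvd_diff)
  moreover have "coprime f1 f2"
  proof -
    have "\<not> f1 dvd f2"
    proof
      assume "f1 dvd f2"
      then obtain c where c: "f2 = f1 * c" by blast
      then have "degree c = 0"
        using f1 f2 assms(8,9) by (auto simp: degree_mult_eq)
      then obtain d where "c = [:d:]"
        by (rule degree_eq_zeroE)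
      then have f2_eq: "f2 = smult d f1"
        using c by simp
      then have "lead_coeff f2 = d * lead_coeff f1"
        by (simp only: lead_coeff_smult)
      then have "d = 1"
        using f1(1) f2(1) by (metis mult.right_neutral)
      then show False
        using f2_eq assms(7) by simp
    qed
    then show ?thesis
      by (rule prime_elem_imp_coprime[OF field_poly_irreducible_imp_prime[OF f1(2)]])
  qed
  ultimately have dvd: "f1 * f2 dvd a * ?b - 1"
    by (simp add: divides_mult)
  have b: "degree ?b < n" "0 < degree ?b"
    using poly_inv_nonconst[OF f1(2), of a] assms by auto
  have deg: "degree (a * ?b) = degree a + degree ?b"
    using assms b by (intro degree_mult_eq) auto
  then have "degree (a * ?b - 1) = degree a + degree ?b"
    using degree_add_eq_left[of "- 1" "a * ?b"] b(2) by simp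
  moreover have "degree (f1 * f2) = n + n"
    using f1 f2 by (subst degree_mult_eq) auto
  moreover have "a * ?b - 1 \<noteq> 0"
    using calculation(1) assms(8) by auto
  ultimately show False
    using dvd_imp_degree_le[OF dvd] b(1) assms(9) by linarith
qed

section \<open>The partition into inverse chains\<close>

theorem corollary2:
  fixes f1 f2 :: "'p::prime_card mod_ring poly" and n :: nat
  assumes "n > 0"
    and "monic f1" "irreducible f1" "degree f1 = n"
    and "monic f2" "irreducible f2" "degree f2 = n"
    and "f1 \<noteq> f2"
  shows "(\<exists>!P. inverse_chain_partition f1 f2 (polys_below n - const_polys) P) \<and>
         (\<forall>P. inverse_chain_partition f1 f2 (polys_below n - const_polys) P \<longrightarrow>
            (\<forall>C\<in>P. even (cycle_length C) \<and> 4 \<le> cycle_length C))"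
proof -
  define A where "A = (polys_below n - const_polys :: 'p mod_ring poly set)"
  have A_iff: "a \<in> A \<longleftrightarrow> 0 < degree a \<and> degree a < n" for a
    unfolding A_def by (rule nonconst_below_iff[OF assms(1)])
  interpret fixed_point_free_involutions A "poly_inv f1" "poly_inv f2"
  proof
    show "finite A"
      unfolding A_def by (intro finite_Diff finite_polys_below)
  qed (use assms(3,4,6,7) poly_inv_nonconst[of f1] poly_inv_nonconst[of f2] in
      \<open>auto simp: A_iff\<close>)
  have walk: "chain_elem f1 f2 a i = walk a i" for a i
    by (induction i) auto
  have chain: "is_inverse_chain f1 f2 a (closed_walk a)" if "a \<in> A" for a
  proof -
    have "closed_walk a = k_chain f1 f2 (period a) a"
      unfolding closed_walk_def k_chain_def by (intro map_cong) (simp_all only: walk)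
    moreover have "closed_walk a ! period a = a"
      using period(3)[OF that] by (simp add: closed_walk_nth)
    ultimately show ?thesis
      unfolding is_inverse_chain_def
      using period(1,2)[OF that] distinct_closed_walk[OF that] by blast
  qed
  have ex: "inverse_chain_partition f1 f2 A (orbit_cycle ` A)"
    unfolding inverse_chain_partition_def
  proof (intro conjI ballI cycle_partition_orbit_cycles)
    fix a assume a: "a \<in> A"
    have "traverses (closed_walk a) C" if "C \<in> orbit_cycle ` A" "a \<in> cycle_verts C" for C
      using that orbit_cycle_eq traverses_orbit_cycle[OF a] by fastforce
    then show "\<exists>xs. is_inverse_chain f1 f2 a xs \<and>
        (\<forall>C\<in>orbit_cycle ` A. a \<in> cycle_verts C \<longrightarrow> traverses xs C)"
      using chain[OF a] by blast
  qed
  have uniq: "P = orbit_cycle ` A" if P: "inverse_chain_partition f1 f2 A P" for P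
  proof -
    have part: "\<forall>C\<in>P. is_ucycle C" "(\<Union>C\<in>P. cycle_verts C) = A"
      using P by (auto simp: inverse_chain_partition_def cycle_partition_def)
    have eq: "C = orbit_cycle a" if C: "C \<in> P" "a \<in> cycle_verts C" for C a
    proof -
      have a: "a \<in> A"
        using part(2) C by blast
      then obtain xs where xs: "is_inverse_chain f1 f2 a xs" "traverses xs C"
        using P C unfolding inverse_chain_partition_def by blast
      have "xs = closed_walk a"
        using is_inverse_chain_unique[OF xs(1) chain[OF a]] .
      then show ?thesis
        using xs(2) traverses_orbit_cycle[OF a] traverses_unique by blast
    qed
    show ?thesis
    proof (intro equalityI subsetI)
      fix C assume C: "C \<in> P"
      then obtain a where "a \<in> cycle_verts C"
        using part(1) cycle_verts_nonempty by blast
      then show "C \<in> orbit_cycle ` A"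
        using eq[OF C] part(2) C by blast
    next
      fix C assume "C \<in> orbit_cycle ` A"
      then obtain a where a: "a \<in> A" "C = orbit_cycle a"
        by blast
      then obtain D where "D \<in> P" "a \<in> cycle_verts D"
        using part(2) by blast
      then show "C \<in> P"
        using eq a by blast
    qed
  qed
  have len: "even (cycle_length C) \<and> 4 \<le> cycle_length C" if C: "C \<in> orbit_cycle ` A" for C
  proof -
    obtain a where a: "a \<in> A" "C = orbit_cycle a"
      using C by blast
    have "poly_inv f1 a \<noteq> poly_inv f2 a"
      using poly_inv_neq_poly_inv[OF assms(2-8)] a(1) by (simp add: A_iff)
    then show ?thesis
      using a period(2) period_ge_4 by (simp add: cycle_length_orbit_cycle)
  qed
  show ?thesis
    unfolding A_def[symmetric] using ex uniq len by blast
qed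

end
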